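(* Let $c>0$ and $\rho>0$ be constants not depending on $n$. Let $\xi_{ij}$, $1\le i,j\le n$, be independent (not necessarily identically distributed) real random variables, each having the $(c,\rho)$-property. Let $M_n$ be the $n\times n$ random matrix with entries $\xi_{ij}$. Then $\mathbf{P}(\det M_n = 0) = o(1)$ as $n\to\infty$.
   Context: A random variable $\xi$ has the $(c,\rho)$-property if $\min\{\mathbf{P}(\xi\ge c),\mathbf{P}(\xi\le -c)\}\ge\rho$. *)

theory Defs
  imports "HOL-Probability.Probability" "Jordan_Normal_Form.Determinant" "HOL-Library.Landau_Symbols"
begin

definition cr_property :: "'a measure \<Rightarrow> real \<Rightarrow> real \<Rightarrow> ('a \<Rightarrow> real) \<Rightarrow> bool" where
  "cr_property M c \<rho> \<xi> \<longleftrightarrow> min \<P>(\<omega> in M. \<xi> \<omega> \<ge> c) \<P>(\<omega> in M. \<xi> \<omega> \<le> - c) \<ge> \<rho>"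

text \<open>Rows and columns are numbered from \<open>0\<close> to \<open>n - 1\<close>.\<close>

definition random_matrix :: "nat \<Rightarrow> (nat \<Rightarrow> nat \<Rightarrow> 'a \<Rightarrow> real) \<Rightarrow> 'a \<Rightarrow> real mat" where
  "random_matrix n \<xi> \<omega> = Matrix.mat n n (\<lambda>(i, j). \<xi> i j \<omega>)"

end

theory Submission imports Defs "HOL-Real_Asymp.Real_Asymp" begin

text \<open>
  This is Komlos's argument. Expose the columns of the matrix one at a time. If fewer than \<open>n - L\<close>
  columns have been exposed, some \<open>L\<close> or more coordinates of every vector in their span are
  determined by the others, so the next column falls into the span with probability geometrically
  small in the codimension. For each of the last \<open>L\<close> columns take a vector \<open>v\<close> orthogonal to the
  columns exposed so far. By a union bound over supports of size \<open>k\<close>, with high probability no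
  vector supported on \<open>k\<close> coordinates is orthogonal to the first \<open>n - L\<close> columns, so \<open>v\<close> has at
  least \<open>k\<close> nonzero entries, and a weak Littlewood--Offord inequality bounds the probability that the
  next column is orthogonal to \<open>v\<close> by a quantity tending to \<open>0\<close> as \<open>k\<close> grows. It remains to choose
  \<open>L\<close>, then \<open>k\<close>, then \<open>n\<close>.
\<close>

section \<open>Linear dependence over finite index sets and its measurability\<close>

text \<open>Dependence is stated for an indexed family rather than for a set of vectors, so two
  equal rows count as dependent. Free index sets \<open>R\<close> and \<open>C\<close> allow rows to
  be added one at a time and the roles of rows and columns to be exchanged by transposing.\<close>

definition lin_dep :: "'r set \<Rightarrow> 'c set \<Rightarrow> ('r \<Rightarrow> 'c \<Rightarrow> real) \<Rightarrow> bool" where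
  "lin_dep R C f \<longleftrightarrow> (\<exists>u. (\<exists>r\<in>R. u r \<noteq> 0) \<and> (\<forall>j\<in>C. (\<Sum>r\<in>R. u r * f r j) = 0))"

lemma lin_dep_cong:
  assumes "\<And>r j. r \<in> R \<Longrightarrow> j \<in> C \<Longrightarrow> f r j = g r j"
  shows "lin_dep R C f \<longleftrightarrow> lin_dep R C g"
proof -
  have "(\<Sum>r\<in>R. u r * f r j) = (\<Sum>r\<in>R. u r * g r j)" if "j \<in> C" for u j
    using assms that by (intro sum.cong) auto
  then show ?thesis unfolding lin_dep_def by simp
qed

lemma not_lin_dep_empty [simp]: "\<not> lin_dep {} C f"
  by (simp add: lin_dep_def)

text \<open>One step of Gaussian elimination: column \<open>j0\<close> determines the coefficient of
  row \<open>r0\<close> from the other coefficients, and substituting it turns the remaining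
  equations into those of the reduced array.\<close>

lemma lin_dep_insert_eliminate:
  assumes "finite R" "r0 \<notin> R" "j0 \<in> C" "f r0 j0 \<noteq> 0"
  shows "lin_dep (insert r0 R) C f \<longleftrightarrow>
    lin_dep R C (\<lambda>r j. f r j - f r j0 / f r0 j0 * f r0 j)"
proof -
  have elim: "(\<Sum>r\<in>R. u r * (f r j - f r j0 / f r0 j0 * f r0 j)) =
      (\<Sum>r\<in>R. u r * f r j) - (\<Sum>r\<in>R. u r * f r j0) / f r0 j0 * f r0 j" for u j
    by (simp add: right_diff_distrib sum_subtractf sum_distrib_right sum_divide_distrib mult.assoc)
  show ?thesis
  proof
    assume "lin_dep (insert r0 R) C f"
    then obtain u where u: "\<exists>r\<in>insert r0 R. u r \<noteq> 0"
      and *: "\<And>j. j \<in> C \<Longrightarrow> u r0 * f r0 j + (\<Sum>r\<in>R. u r * f r j) = 0"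
      unfolding lin_dep_def using assms by auto
    have s: "(\<Sum>r\<in>R. u r * f r j0) / f r0 j0 = - u r0"
      using *[OF \<open>j0 \<in> C\<close>] assms by (simp add: field_simps)
    have "\<exists>r\<in>R. u r \<noteq> 0"
    proof (rule ccontr)
      assume "\<not> ?thesis"
      moreover from this have "(\<Sum>r\<in>R. u r * f r j0) = 0" by simp
      ultimately show False using u s by auto
    qed
    moreover have "(\<Sum>r\<in>R. u r * (f r j - f r j0 / f r0 j0 * f r0 j)) = 0" if "j \<in> C" for j
      using *[OF that] unfolding elim s by simp
    ultimately show "lin_dep R C (\<lambda>r j. f r j - f r j0 / f r0 j0 * f r0 j)"
      unfolding lin_dep_def by blast
  next
    assume "lin_dep R C (\<lambda>r j. f r j - f r j0 / f r0 j0 * f r0 j)"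
    then obtain u where u: "\<exists>r\<in>R. u r \<noteq> 0"
      and *: "\<And>j. j \<in> C \<Longrightarrow> (\<Sum>r\<in>R. u r * f r j) - (\<Sum>r\<in>R. u r * f r j0) / f r0 j0 * f r0 j = 0"
      unfolding lin_dep_def elim by auto
    define u' where "u' = u(r0 := - ((\<Sum>r\<in>R. u r * f r j0) / f r0 j0))"
    have "(\<Sum>r\<in>R. u' r * f r j) = (\<Sum>r\<in>R. u r * f r j)" for j
      using assms by (intro sum.cong) (auto simp: u'_def)
    then have "(\<Sum>r\<in>insert r0 R. u' r * f r j) = 0" if "j \<in> C" for j
      using *[OF that] assms by (simp add: u'_def)
    moreover have "\<exists>r\<in>insert r0 R. u' r \<noteq> 0"
      using u assms by (auto simp: u'_def)
    ultimately show "lin_dep (insert r0 R) C f"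
      unfolding lin_dep_def by blast
  qed
qed

lemma lin_dep_insert_iff:
  assumes "finite R" "r0 \<notin> R"
  shows "lin_dep (insert r0 R) C f \<longleftrightarrow> (\<forall>j\<in>C. f r0 j = 0) \<or>
    (\<exists>j0\<in>C. f r0 j0 \<noteq> 0 \<and> lin_dep R C (\<lambda>r j. f r j - f r j0 / f r0 j0 * f r0 j))"
proof (cases "\<forall>j\<in>C. f r0 j = 0")
  case True
  have "(\<Sum>r\<in>insert r0 R. (if r = r0 then 1 else 0) * f r j) = 0" if "j \<in> C" for j
    using assms True that by (auto intro!: sum.neutral)
  then have "lin_dep (insert r0 R) C f"
    unfolding lin_dep_def by (intro exI[of _ "\<lambda>r. if r = r0 then 1 else 0"]) auto
  with True show ?thesis by simp
next
  case False
  then show ?thesis using lin_dep_insert_eliminate[of R r0 _ C f, OF assms] by blast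
qed

text \<open>Gaussian elimination expresses dependence through finitely many measurable operations on the entries.\<close>

lemma sets_lin_dep:
  assumes "finite R" "finite C"
    and "\<And>r j. r \<in> R \<Longrightarrow> j \<in> C \<Longrightarrow> (\<lambda>x. f x r j) \<in> borel_measurable N"
  shows "{x \<in> space N. lin_dep R C (f x)} \<in> sets N"
  using assms(1,3)
proof (induction R arbitrary: f rule: finite_induct)
  case empty
  then show ?case by simp
next
  case (insert r0 R)
  have [measurable]: "(\<lambda>x. f x r j) \<in> borel_measurable N" if "r \<in> insert r0 R" "j \<in> C" for r j
    using insert.prems that by blast
  have "{x \<in> space N. lin_dep (insert r0 R) C (f x)} =
      {x \<in> space N. \<forall>j\<in>C. f x r0 j = 0} \<union> (\<Union>j0\<in>C. {x \<in> space N. f x r0 j0 \<noteq> 0} \<inter>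
        {x \<in> space N. lin_dep R C (\<lambda>r j. f x r j - f x r j0 / f x r0 j0 * f x r0 j)})"
    by (auto simp: lin_dep_insert_iff[OF insert.hyps])
  also have "\<dots> \<in> sets N"
  proof (intro sets.Un sets.finite_UN sets.Int \<open>finite C\<close>)
    show "{x \<in> space N. \<forall>j\<in>C. f x r0 j = 0} \<in> sets N"
      using \<open>finite C\<close> by (intro sets.sets_Collect_finite_All) measurable
    fix j0 assume j0: "j0 \<in> C"
    show "{x \<in> space N. f x r0 j0 \<noteq> 0} \<in> sets N"
      using j0 by measurable
    show "{x \<in> space N. lin_dep R C (\<lambda>r j. f x r j - f x r j0 / f x r0 j0 * f x r0 j)} \<in> sets N"
      using j0 by (intro insert.IH) measurable
  qed
  finally show ?case .
qed

section \<open>Pivot columns and orthogonal vectors\<close>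

text \<open>Column rank is at most row rank: each new row requires at most one new pivot column. The
  explicit coefficients matter because every vector in the span of the rows inherits the same
  relations between its coordinates.\<close>

lemma pivot_columns:
  fixes f :: "'r \<Rightarrow> 'c \<Rightarrow> real"
  assumes "finite R" "finite C"
  shows "\<exists>T c. T \<subseteq> C \<and> card T \<le> card R \<and> (\<forall>r\<in>R. \<forall>j\<in>C. f r j = (\<Sum>t\<in>T. c j t * f r t))"
  using assms(1)
proof (induction R rule: finite_induct)
  case empty
  show ?case by (intro exI[of _ "{}"]) simp
next
  case (insert r0 R)
  then obtain T c where T: "T \<subseteq> C" "card T \<le> card R"
    and c: "\<And>r j. r \<in> R \<Longrightarrow> j \<in> C \<Longrightarrow> f r j = (\<Sum>t\<in>T. c j t * f r t)" by blast
  have fT: "finite T" using T assms finite_subset by blast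
  define e where "e r j = f r j - (\<Sum>t\<in>T. c j t * f r t)" for r j
  show ?case
  proof (cases "\<forall>j\<in>C. e r0 j = 0")
    case True
    then have "\<forall>r\<in>insert r0 R. \<forall>j\<in>C. f r j = (\<Sum>t\<in>T. c j t * f r t)"
      using c by (auto simp: e_def)
    moreover have "card T \<le> card (insert r0 R)" using T insert.hyps by simp
    ultimately show ?thesis using T by blast
  next
    case False
    then obtain j0 where j0: "j0 \<in> C" "e r0 j0 \<noteq> 0" by blast
    define d where "d j = e r0 j / e r0 j0" for j
    \<comment> \<open>The old expansion of column \<open>j\<close> is corrected by
      \<open>d j\<close> times the residual of column \<open>j0\<close>, which vanishes on the old
      rows and equals \<open>e r0 j0\<close> on the new one. The two conditionals are added, not
      alternatives, since \<open>j0\<close> may already lie in \<open>T\<close>.\<close>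
    define c' where "c' j t = (if t \<in> T then c j t - d j * c j0 t else 0) + (if t = j0 then d j else 0)" for j t
    have fin: "finite (insert j0 T)" using fT by simp
    have sum_c': "(\<Sum>t\<in>insert j0 T. c' j t * f r t) = (\<Sum>t\<in>T. c j t * f r t) + d j * e r j0" for r j
    proof -
      have "(\<Sum>t\<in>insert j0 T. c' j t * f r t) =
          (\<Sum>t\<in>insert j0 T. (if t \<in> T then (c j t - d j * c j0 t) * f r t else 0)) +
          (\<Sum>t\<in>insert j0 T. (if t = j0 then d j * f r t else 0))"
        unfolding sum.distrib[symmetric] by (intro sum.cong) (auto simp: c'_def algebra_simps)
      also have "(\<Sum>t\<in>insert j0 T. (if t \<in> T then (c j t - d j * c j0 t) * f r t else 0)) =
          (\<Sum>t\<in>T. (c j t - d j * c j0 t) * f r t)"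
        using fin by (intro sum.mono_neutral_cong_right) auto
      also have "(\<Sum>t\<in>insert j0 T. (if t = j0 then d j * f r t else 0)) = d j * f r j0"
        using fin by (subst sum.delta) auto
      finally show ?thesis
        by (simp add: e_def algebra_simps sum_subtractf sum_distrib_left)
    qed
    have "f r j = (\<Sum>t\<in>insert j0 T. c' j t * f r t)" if "r \<in> insert r0 R" "j \<in> C" for r j
    proof (cases "r \<in> R")
      case True
      then have "e r j0 = 0" using c j0 by (simp add: e_def)
      then show ?thesis unfolding sum_c' using c[OF True that(2)] by simp
    next
      case False
      then have "r = r0" using that by simp
      then show ?thesis unfolding sum_c' using j0 by (simp add: d_def) (simp add: e_def)
    qed
    moreover have "card (insert j0 T) \<le> card (insert r0 R)"
      using T insert.hyps card_insert_le_m1[of "Suc (card R)" T j0] fT by (simp add: card_insert_if)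
    ultimately show ?thesis using T j0 by (intro exI[of _ "insert j0 T"] exI[of _ c']) auto
  qed
qed

text \<open>By counting, some column \<open>j0\<close> is not a pivot. The unit vector at
  \<open>j0\<close> minus the coefficients expressing column \<open>j0\<close> through the pivots is
  orthogonal to all rows.\<close>

lemma orthogonal_vector_exists:
  fixes f :: "'r \<Rightarrow> 'c \<Rightarrow> real"
  assumes "finite R" "finite C" "card R < card C"
  shows "\<exists>v. (\<exists>j\<in>C. v j \<noteq> 0) \<and> (\<forall>r\<in>R. (\<Sum>j\<in>C. v j * f r j) = 0)"
proof -
  obtain T c where T: "T \<subseteq> C" "card T \<le> card R"
    and c: "\<forall>r\<in>R. \<forall>j\<in>C. f r j = (\<Sum>t\<in>T. c j t * f r t)"
    using pivot_columns[OF assms(1,2), of f] by blast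
  have "T \<noteq> C" using T assms by auto
  then obtain j0 where j0: "j0 \<in> C" "j0 \<notin> T" using T by blast
  define v where "v j = (if j = j0 then 1 else 0) - (if j \<in> T then c j0 j else 0)" for j
  have "(\<Sum>j\<in>C. v j * f r j) = 0" if "r \<in> R" for r
  proof -
    have "(\<Sum>j\<in>C. v j * f r j) =
        (\<Sum>j\<in>C. if j = j0 then f r j else 0) - (\<Sum>j\<in>C. if j \<in> T then c j0 j * f r j else 0)"
      unfolding sum_subtractf[symmetric] by (intro sum.cong) (auto simp: v_def algebra_simps)
    also have "(\<Sum>j\<in>C. if j \<in> T then c j0 j * f r j else 0) = (\<Sum>j\<in>T. c j0 j * f r j)"
      using T assms by (intro sum.mono_neutral_cong_right) auto
    also have "(\<Sum>j\<in>C. if j = j0 then f r j else 0) = f r j0"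
      using assms j0 by (subst sum.delta) auto
    finally show ?thesis using c that j0 by simp
  qed
  moreover have "v j0 \<noteq> 0" using j0 by (simp add: v_def)
  ultimately show ?thesis using j0 by blast
qed

lemma in_span_of_lin_dep_insert:
  assumes "finite R" "r0 \<notin> R" "lin_dep (insert r0 R) C f" "\<not> lin_dep R C f"
  obtains w where "\<And>j. j \<in> C \<Longrightarrow> f r0 j = (\<Sum>r\<in>R. w r * f r j)"
proof -
  obtain u where u: "\<exists>r\<in>insert r0 R. u r \<noteq> 0"
    and *: "\<And>j. j \<in> C \<Longrightarrow> u r0 * f r0 j + (\<Sum>r\<in>R. u r * f r j) = 0"
    using assms unfolding lin_dep_def by auto
  have "u r0 \<noteq> 0"
  proof
    assume "u r0 = 0"
    with u * assms(4) show False unfolding lin_dep_def by auto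
  qed
  then have "f r0 j = (\<Sum>r\<in>R. (- u r / u r0) * f r j)" if "j \<in> C" for j
    using *[OF that] by (simp add: sum_negf sum_divide_distrib[symmetric] field_simps)
  then show thesis by (rule that)
qed

section \<open>Independence and conditioning\<close>

context prob_space
begin

text \<open>The joint law of an independent pair is the product of the two laws, so Tonelli applies.
  Pulling both integrals back to \<open>M\<close> amounts to doubling the sample point.\<close>

lemma emeasure_indep_var_pair:
  assumes ind: "indep_var S X T Y" and A: "A \<in> sets (S \<Otimes>\<^sub>M T)"
  shows "emeasure M {\<omega> \<in> space M. (X \<omega>, Y \<omega>) \<in> A} =
    (\<integral>\<^sup>+\<omega>. emeasure M {\<omega>' \<in> space M. (X \<omega>, Y \<omega>') \<in> A} \<partial>M)"
proof -
  have X: "X \<in> measurable M S" and Y: "Y \<in> measurable M T"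
    using ind by (auto dest: indep_var_rv1 indep_var_rv2)
  interpret X: prob_space "distr M S X" using X by (rule prob_space_distr)
  interpret Y: prob_space "distr M T Y" using Y by (rule prob_space_distr)
  have A': "A \<in> sets (distr M S X \<Otimes>\<^sub>M distr M T Y)" using A by simp
  have "emeasure M {\<omega> \<in> space M. (X \<omega>, Y \<omega>) \<in> A} =
      emeasure (distr M (S \<Otimes>\<^sub>M T) (\<lambda>\<omega>. (X \<omega>, Y \<omega>))) A"
    using X Y A by (subst emeasure_distr) (auto intro!: arg_cong[where f="emeasure M"])
  also have "\<dots> = emeasure (distr M S X \<Otimes>\<^sub>M distr M T Y) A"
    using ind by (simp add: indep_var_distribution_eq)
  also have "\<dots> = (\<integral>\<^sup>+x. emeasure (distr M T Y) (Pair x -` A) \<partial>distr M S X)"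
    by (rule Y.emeasure_pair_measure_alt[OF A'])
  also have "\<dots> = (\<integral>\<^sup>+\<omega>. emeasure (distr M T Y) (Pair (X \<omega>) -` A) \<partial>M)"
    using X Y.measurable_emeasure_Pair[OF A'] by (intro nn_integral_distr) auto
  also have "\<dots> = (\<integral>\<^sup>+\<omega>. emeasure M {\<omega>' \<in> space M. (X \<omega>, Y \<omega>') \<in> A} \<partial>M)"
  proof (intro nn_integral_cong)
    fix \<omega>
    have "Pair (X \<omega>) -` A \<in> sets T" using A by (rule sets_Pair1)
    then show "emeasure (distr M T Y) (Pair (X \<omega>) -` A) = emeasure M {\<omega>' \<in> space M. (X \<omega>, Y \<omega>') \<in> A}"
      using Y by (subst emeasure_distr) (auto intro!: arg_cong[where f="emeasure M"])
  qed
  finally show ?thesis .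
qed

text \<open>Conditioning on the coordinates outside \<open>K\<close>, without conditional expectations.\<close>

lemma prob_le_of_freeze:
  fixes X :: "'i \<Rightarrow> 'a \<Rightarrow> real"
  assumes ind: "indep_vars (\<lambda>_. borel) X I" and "K \<subseteq> I"
    and P: "{x \<in> space (PiM I (\<lambda>_. borel)). P x} \<in> sets (PiM I (\<lambda>_. borel))"
    and bound: "\<And>y. prob {\<omega> \<in> space M. P (\<lambda>i\<in>I. if i \<in> K then X i \<omega> else y i)} \<le> \<delta>"
  shows "prob {\<omega> \<in> space M. P (\<lambda>i\<in>I. X i \<omega>)} \<le> \<delta>"
proof -
  let ?B = "\<lambda>J. PiM J (\<lambda>_. borel :: real measure)"
  let ?X = "\<lambda>J \<omega>. \<lambda>i\<in>J. X i \<omega>"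
  define A where "A = {x \<in> space (?B I). P x}"
  \<comment> \<open>The event read on pairs of blocks: coordinates outside \<open>K\<close> first,
    those in \<open>K\<close> second.\<close>
  define A' where "A' = merge (I - K) K -` A \<inter> space (?B (I - K) \<Otimes>\<^sub>M ?B K)"
  have I: "(I - K) \<union> K = I" using \<open>K \<subseteq> I\<close> by blast
  have "merge (I - K) K \<in> measurable (?B (I - K) \<Otimes>\<^sub>M ?B K) (?B I)"
    using measurable_merge[of "I - K" K "\<lambda>_. borel"] unfolding I .
  then have A': "A' \<in> sets (?B (I - K) \<Otimes>\<^sub>M ?B K)"
    unfolding A'_def A_def using P by (rule measurable_sets)
  have ind2: "indep_var (?B (I - K)) (?X (I - K)) (?B K) (?X K)"
    using \<open>K \<subseteq> I\<close> by (intro indep_var_restrict[OF ind]) auto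
  have mem: "(?X (I - K) \<omega>, ?X K \<omega>') \<in> A' \<longleftrightarrow> P (\<lambda>i\<in>I. if i \<in> K then X i \<omega>' else X i \<omega>)" for \<omega> \<omega>'
  proof -
    have "merge (I - K) K (?X (I - K) \<omega>, ?X K \<omega>') = (\<lambda>i\<in>I. if i \<in> K then X i \<omega>' else X i \<omega>)"
      using \<open>K \<subseteq> I\<close> by (auto simp: merge_def fun_eq_iff)
    then show ?thesis
      by (auto simp: A'_def A_def space_pair_measure space_PiM)
  qed
  \<comment> \<open>Any single \<open>y\<close> suffices: \<open>\<delta>\<close> dominates a
    probability, hence is nonnegative, as the return from \<open>ennreal\<close> requires.\<close>
  have \<delta>: "\<delta> \<ge> 0" using bound[of undefined] measure_nonneg order_trans by blast
  have "emeasure M {\<omega> \<in> space M. P (\<lambda>i\<in>I. X i \<omega>)} =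
      emeasure M {\<omega> \<in> space M. (?X (I - K) \<omega>, ?X K \<omega>) \<in> A'}"
    unfolding mem by (intro arg_cong[where f="emeasure M"]) simp
  also have "\<dots> = (\<integral>\<^sup>+\<omega>. emeasure M {\<omega>' \<in> space M. (?X (I - K) \<omega>, ?X K \<omega>') \<in> A'} \<partial>M)"
    by (rule emeasure_indep_var_pair[OF ind2 A'])
  also have "\<dots> \<le> (\<integral>\<^sup>+\<omega>. ennreal \<delta> \<partial>M)"
    unfolding mem using bound by (intro nn_integral_mono) (simp add: emeasure_eq_measure ennreal_leI)
  also have "\<dots> = ennreal \<delta>"
    by (simp add: emeasure_space_1)
  finally show ?thesis
    using \<delta> by (simp add: emeasure_eq_measure ennreal_le_iff)
qed

section \<open>A weak Littlewood--Offord inequality\<close>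

text \<open>The majorant \<open>m/N + \<theta>\<^sup>k m (N - m)\<close> is a supersolution of the lazy heat equation on \<open>{0..N}\<close>:
  if \<open>y > 0 > y'\<close> then moving one point from \<open>A - y\<close> to \<open>A - y'\<close> turns two sets of size \<open>m\<close>
  into sets of sizes \<open>m - 1\<close> and \<open>m + 1\<close>.\<close>

lemma prob_sum_mem_le:
  fixes Y :: "'i \<Rightarrow> 'a \<Rightarrow> real"
  assumes "finite J" "indep_vars (\<lambda>_. borel) Y J"
    and "\<And>j. j \<in> J \<Longrightarrow> \<rho> \<le> prob {\<omega> \<in> space M. Y j \<omega> > 0}"
    and "\<And>j. j \<in> J \<Longrightarrow> \<rho> \<le> prob {\<omega> \<in> space M. Y j \<omega> < 0}"
    and "0 \<le> \<rho>" "\<rho> \<le> 1" "N > 0" "finite A" "card A \<le> N"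
  shows "prob {\<omega> \<in> space M. (\<Sum>j\<in>J. Y j \<omega>) \<in> A} \<le>
    real (card A) / real N + (1 - \<rho> / (real N)\<^sup>2) ^ card J * (real (card A) * (real N - real (card A)))"
  using assms
proof (induction J arbitrary: A rule: finite_induct)
  case empty
  show ?case
  proof (cases "A = {} \<or> card A = N")
    case True
    then show ?thesis using \<open>N > 0\<close> by auto
  next
    case False
    \<comment> \<open>The empty sum is constant, and the trivial bound 1 is enough:
      \<open>m * (N - m)\<close> is at least 1 for \<open>0 < m < N\<close>.\<close>
    then have "1 \<le> card A" "card A + 1 \<le> N"
      using empty.prems by (auto simp: Suc_le_eq card_gt_0_iff)
    then have "1 * 1 \<le> real (card A) * (real N - real (card A))"
      by (intro mult_mono) (simp_all add: le_diff_eq flip: of_nat_Suc)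
    moreover have "0 \<le> real (card A) / real N" by simp
    ultimately have "1 \<le> real (card A) / real N + real (card A) * (real N - real (card A))" by linarith
    then show ?thesis using prob_le_1 order_trans by simp blast
  qed
next
  case (insert i J)
  define \<theta> where "\<theta> = 1 - \<rho> / (real N)\<^sup>2"
  define G where "G m = m / real N + \<theta> ^ card J * (m * (real N - m))" for m
  define S where "S \<omega> = (\<Sum>j\<in>J. Y j \<omega>)" for \<omega>
  define p where "p B = prob {\<omega> \<in> space M. S \<omega> \<in> B}" for B
  define m where "m = card A"
  have N1: "1 \<le> (real N)\<^sup>2" using \<open>N > 0\<close> by (simp add: one_le_power)
  have \<theta>0: "0 \<le> \<theta>"
    using N1 \<open>\<rho> \<le> 1\<close> by (simp add: \<theta>_def divide_le_eq)
  have rv: "random_variable borel (Y j)" if "j \<in> insert i J" for j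
    using insert.prems(1) that by (auto simp: indep_vars_def)
  then have [measurable]: "random_variable borel S" "random_variable borel (Y i)"
    unfolding S_def by (auto intro!: borel_measurable_sum)
  have IH: "p B \<le> G (card B)" if "finite B" "card B \<le> N" for B
    unfolding p_def S_def G_def \<theta>_def using insert.prems that
    by (intro insert.IH) (auto intro: indep_vars_subset)
  have p_insert: "p (insert e B) = p B + p {e}" if "finite B" "e \<notin> B" for e B
  proof -
    have ev: "{\<omega> \<in> space M. S \<omega> \<in> B'} \<in> events" if "finite B'" for B'
      using measurable_sets[OF \<open>random_variable borel S\<close>, of B'] finite_imp_closed[OF that]
      by (simp add: vimage_def Int_def conj_commute)
    have "{\<omega> \<in> space M. S \<omega> \<in> insert e B} = {\<omega> \<in> space M. S \<omega> \<in> B} \<union> {\<omega> \<in> space M. S \<omega> \<in> {e}}"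
      by auto
    then show ?thesis
      unfolding p_def using that ev by (subst finite_measure_Union[symmetric]) auto
  qed
  have sum_insert: "(\<Sum>j\<in>insert i J. Y j \<omega>) = Y i \<omega> + S \<omega>" for \<omega>
    using insert.hyps by (simp add: S_def)
  show ?case
  proof (cases "A = {} \<or> card A = N")
    case True
    then show ?thesis using \<open>N > 0\<close> by auto
  next
    case False
    then have m: "1 \<le> m" "m + 1 \<le> N"
      using insert.prems by (auto simp: Suc_le_eq card_gt_0_iff m_def)
    \<comment> \<open>\<open>sh y\<close> is the set that the remaining sum \<open>S\<close> has to
      hit once \<open>Y i\<close> takes the value \<open>y\<close>.\<close>
    define sh where "sh y = (\<lambda>a. a - y) ` A" for y :: real
    have fin_sh: "finite (sh y)" and card_sh: "card (sh y) = m" for y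
      using insert.prems by (auto simp: sh_def m_def card_image inj_on_def)
    have p_sh: "p (sh y) \<le> G m" for y
      using IH[OF fin_sh, of y] m by (simp add: card_sh)
    define d where "d = \<theta> ^ card J"
    have d0: "0 \<le> d" using \<theta>0 by (simp add: d_def)
    have pair: "p (sh y) + p (sh y') \<le> 2 * (G m - d)" if "y < y'" for y y'
    proof -
      \<comment> \<open>A nonempty finite set differs from its proper translates, because the
        maximum moves. As both translates have \<open>m\<close> elements, \<open>sh y\<close> then
        contains a point \<open>e\<close> missing from \<open>sh y'\<close>.\<close>
      have "sh y \<noteq> sh y'"
      proof
        assume eq: "sh y = sh y'"
        have ne: "A \<noteq> {}" "finite A" using False insert.prems by auto
        then have "Max A - y \<in> sh y" by (auto simp: sh_def)
        then obtain a where "a \<in> A" "Max A - y = a - y'" unfolding eq by (auto simp: sh_def)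
        then show False using Max_ge[OF ne(2), of a] that by simp
      qed
      then obtain e where e: "e \<in> sh y" "e \<notin> sh y'"
        using card_subset_eq[OF fin_sh, of "sh y" y'] by (auto simp: card_sh)
      have "p (sh y) = p (sh y - {e}) + p {e}"
        using p_insert[of "sh y - {e}" e] e fin_sh[of y] by (simp add: insert_absorb)
      moreover have "p (insert e (sh y')) = p (sh y') + p {e}"
        using p_insert e fin_sh by blast
      moreover have "p (sh y - {e}) \<le> G (real m - 1)"
        using IH[of "sh y - {e}"] e m fin_sh by (simp add: card_sh of_nat_diff)
      moreover have "p (insert e (sh y')) \<le> G (real m + 1)"
        using IH[of "insert e (sh y')"] e m fin_sh by (simp add: card_sh add.commute)
      \<comment> \<open>The first part of \<open>G\<close> is affine, and the second difference of
        \<open>m * (N - m)\<close> is -2. This is the gain of \<open>d\<close> per set.\<close>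
      moreover have "G (real m - 1) + G (real m + 1) = 2 * (G m - d)"
        by (simp add: G_def d_def algebra_simps add_divide_distrib diff_divide_distrib)
      ultimately show ?thesis by linarith
    qed
    \<comment> \<open>A violation on each side of 0 would contradict \<open>pair\<close>, so the
      improved bound holds on an entire open half-line. The variable \<open>Y i\<close> lies there
      with probability at least \<open>\<rho>\<close>, whichever side it is.\<close>
    have half: "(\<forall>y>0. p (sh y) \<le> G m - d) \<or> (\<forall>y<0. p (sh y) \<le> G m - d)"
    proof (rule ccontr)
      assume "\<not> ?thesis"
      then obtain y y' where "y > 0" "y' < 0" "p (sh y) > G m - d" "p (sh y') > G m - d"
        by (auto simp: not_le)
      then show False using pair[of y' y] by simp
    qed
    obtain Q where Q: "Q = {0<..} \<or> Q = {..<0::real}" and pQ: "\<And>y. y \<in> Q \<Longrightarrow> p (sh y) \<le> G m - d"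
      using half by (metis greaterThan_iff lessThan_iff)
    have Qm [measurable]: "Q \<in> sets borel" using Q by auto
    have \<rho>Q: "\<rho> \<le> prob {\<omega> \<in> space M. Y i \<omega> \<in> Q}"
      using Q insert.prems(2,3)[of i] by auto
    \<comment> \<open>One of 1 and -1 lies in \<open>Q\<close>, and there \<open>G m - d\<close>
      dominates a probability. Nonnegativity keeps the integrals below faithful in
      \<open>ennreal\<close>.\<close>
    have Gd: "0 \<le> G m - d"
      using pQ[of "1"] pQ[of "-1"] Q measure_nonneg unfolding p_def by (smt (verit) greaterThan_iff lessThan_iff)
    have ind: "indep_var borel (Y i) borel S"
      unfolding S_def using insert.hyps insert.prems by (intro indep_vars_sum) auto
    have clA: "closed A" using insert.prems by (simp add: finite_imp_closed)
    have Am: "{z. fst z + snd z \<in> A} \<in> sets (borel \<Otimes>\<^sub>M (borel :: real measure))"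
    proof -
      have "(\<lambda>z. fst z + snd z) -` A \<inter> space (borel \<Otimes>\<^sub>M (borel :: real measure)) \<in> sets (borel \<Otimes>\<^sub>M (borel :: real measure))"
        using clA by (intro measurable_sets[where A=borel]) (auto intro!: borel_measurable_add)
      then show ?thesis by (simp add: vimage_def space_pair_measure)
    qed
    have "emeasure M {\<omega> \<in> space M. (\<Sum>j\<in>insert i J. Y j \<omega>) \<in> A} =
        emeasure M {\<omega> \<in> space M. (Y i \<omega>, S \<omega>) \<in> {z. fst z + snd z \<in> A}}"
      by (simp add: sum_insert)
    also have "\<dots> = (\<integral>\<^sup>+\<omega>. emeasure M {\<omega>' \<in> space M. (Y i \<omega>, S \<omega>') \<in> {z. fst z + snd z \<in> A}} \<partial>M)"
      by (rule emeasure_indep_var_pair[OF ind Am])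
    also have "\<dots> = (\<integral>\<^sup>+\<omega>. ennreal (p (sh (Y i \<omega>))) \<partial>M)"
    proof (intro nn_integral_cong)
      fix \<omega>
      have "Y i \<omega> + s \<in> A \<longleftrightarrow> s \<in> sh (Y i \<omega>)" for s
        by (force simp: sh_def)
      then show "emeasure M {\<omega>' \<in> space M. (Y i \<omega>, S \<omega>') \<in> {z. fst z + snd z \<in> A}} = ennreal (p (sh (Y i \<omega>)))"
        by (simp add: p_def emeasure_eq_measure)
    qed
    also have "\<dots> \<le> (\<integral>\<^sup>+\<omega>. ennreal (G m - d * indicator {\<omega> \<in> space M. Y i \<omega> \<in> Q} \<omega>) \<partial>M)"
      using p_sh pQ by (intro nn_integral_mono ennreal_leI) (auto simp: indicator_def)
    also have "\<dots> = ennreal (\<integral>\<omega>. G m - d * indicator {\<omega> \<in> space M. Y i \<omega> \<in> Q} \<omega> \<partial>M)"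
    proof (rule nn_integral_eq_integral)
      show "integrable M (\<lambda>\<omega>. G m - d * indicator {\<omega> \<in> space M. Y i \<omega> \<in> Q} \<omega>)"
        by (intro Bochner_Integration.integrable_diff integrable_mult_right integrable_real_indicator)
          (auto simp: emeasure_eq_measure)
      show "AE \<omega> in M. 0 \<le> G m - d * indicator {\<omega> \<in> space M. Y i \<omega> \<in> Q} \<omega>"
        using Gd d0 by (intro AE_I2) (auto simp: indicator_def)
    qed
    finally have "prob {\<omega> \<in> space M. (\<Sum>j\<in>insert i J. Y j \<omega>) \<in> A} \<le>
        (\<integral>\<omega>. G m - d * indicator {\<omega> \<in> space M. Y i \<omega> \<in> Q} \<omega> \<partial>M)"
      using Gd d0 by (subst (asm) emeasure_eq_measure, subst (asm) ennreal_le_iff)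
        (auto intro!: integral_nonneg_AE simp: indicator_def)
    also have "\<dots> = G m - d * prob {\<omega> \<in> space M. Y i \<omega> \<in> Q}"
      by (subst Bochner_Integration.integral_diff)
        (auto intro!: integrable_mult_right integrable_real_indicator simp: prob_space emeasure_eq_measure)
    also have "\<dots> \<le> G m - d * \<rho>"
      using \<rho>Q d0 by (simp add: mult_left_mono)
    also have "\<dots> \<le> m / real N + \<theta> ^ card (insert i J) * (m * (real N - m))"
    proof -
      \<comment> \<open>The additive gain \<open>\<rho>\<close> becomes the factor
        \<open>\<theta>\<close>: since \<open>m * (N - m)\<close> is at most the square of
        \<open>N\<close>, subtracting \<open>\<rho>\<close> takes away at least the proportion
        \<open>1 - \<theta>\<close>.\<close>
      have "real m * (real N - real m) \<le> real N * real N"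
        using m by (intro mult_mono) auto
      then have "\<rho> * (real m * (real N - real m) / (real N)\<^sup>2) \<le> \<rho> * 1"
        using \<open>0 \<le> \<rho>\<close> \<open>N > 0\<close> by (intro mult_left_mono) (auto simp: power2_eq_square divide_le_eq)
      then have "real m * (real N - real m) - \<rho> \<le> \<theta> * (real m * (real N - real m))"
        unfolding \<theta>_def left_diff_distrib by simp
      then have "d * (real m * (real N - real m) - \<rho>) \<le> d * (\<theta> * (real m * (real N - real m)))"
        using d0 by (rule mult_left_mono)
      then show ?thesis
        using insert.hyps by (simp add: G_def d_def algebra_simps)
    qed
    finally show ?thesis by (simp add: \<theta>_def m_def)
  qed
qed

section \<open>The probability that a new row falls into the span of the earlier ones\<close>

text \<open>An injection matches finite subfamilies, so the product formula transfers. It serves to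
  extract one row of an array and to transpose the array.\<close>

lemma indep_vars_reindex:
  assumes ind: "indep_vars M' X I" and e: "inj_on e J" "e ` J \<subseteq> I"
  shows "indep_vars (\<lambda>j. M' (e j)) (\<lambda>j. X (e j)) J"
  unfolding indep_vars_def2
proof (intro conjI ballI indep_setsI)
  note ind' = ind[unfolded indep_vars_def2]
  show "random_variable (M' (e j)) (X (e j))" if "j \<in> J" for j
    using ind' e that by blast
  show "{X (e j) -` A \<inter> space M |A. A \<in> sets (M' (e j))} \<subseteq> events" if "j \<in> J" for j
    using ind' e that by (auto intro!: measurable_sets)
  fix A K assume K: "K \<noteq> {}" "K \<subseteq> J" "finite K"
    and A: "\<forall>j\<in>K. A j \<in> {X (e j) -` A \<inter> space M |A. A \<in> sets (M' (e j))}"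
  have injK: "inj_on e K" using e K inj_on_subset by blast
  define A' where "A' i = A (inv_into K e i)" for i
  have A': "A' (e j) = A j" if "j \<in> K" for j
    using that injK by (simp add: A'_def)
  have "prob (\<Inter>i\<in>e ` K. A' i) = (\<Prod>i\<in>e ` K. prob (A' i))"
  proof (rule indep_setsD)
    show "indep_sets (\<lambda>i. {X i -` A \<inter> space M |A. A \<in> sets (M' i)}) I"
      using ind' by blast
    show "e ` K \<subseteq> I" "e ` K \<noteq> {}" "finite (e ` K)" using K e by auto
    show "\<forall>i\<in>e ` K. A' i \<in> {X i -` A \<inter> space M |A. A \<in> sets (M' i)}"
      using A A' by auto
  qed
  then show "prob (\<Inter>j\<in>K. A j) = (\<Prod>j\<in>K. prob (A j))"
    using A' by (simp add: prod.reindex[OF injK])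
qed

text \<open>Once the coordinates in \<open>T\<close> are frozen, each of the others has to hit a
  prescribed number, and these events are independent.\<close>

lemma prob_linear_relations_le:
  fixes Y :: "'c \<Rightarrow> 'a \<Rightarrow> real"
  assumes ind: "indep_vars (\<lambda>_. borel) Y C" and "finite C" "T \<subseteq> C" "0 \<le> q"
    and atom: "\<And>j a. j \<in> C \<Longrightarrow> prob {\<omega> \<in> space M. Y j \<omega> = a} \<le> q"
  shows "prob {\<omega> \<in> space M. \<forall>j\<in>C - T. Y j \<omega> = (\<Sum>t\<in>T. c j t * Y t \<omega>)} \<le> q ^ card (C - T)"
proof -
  have sum_restrict: "(\<Sum>t\<in>T. c j t * (\<lambda>i\<in>C. z i) t) = (\<Sum>t\<in>T. c j t * z t)" for z :: "'c \<Rightarrow> real" and j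
    using \<open>T \<subseteq> C\<close> by (intro sum.cong) auto
  let ?P = "\<lambda>x. \<forall>j\<in>C - T. x j = (\<Sum>t\<in>T. c j t * x t)"
  have "prob {\<omega> \<in> space M. ?P (\<lambda>i\<in>C. Y i \<omega>)} \<le> q ^ card (C - T)"
  proof (rule prob_le_of_freeze[OF ind, of "C - T"])
    show "C - T \<subseteq> C" by blast
    have "{x \<in> space (PiM C (\<lambda>_. borel)). x j = (\<Sum>t\<in>T. c j t * x t)} \<in> sets (PiM C (\<lambda>_. borel))"
      if "j \<in> C - T" for j
    proof -
      have [measurable]: "(\<lambda>x. x i) \<in> borel_measurable (PiM C (\<lambda>_. borel))" if "i \<in> C" for i
        using that by (rule measurable_component_singleton)
      show ?thesis
        using that \<open>T \<subseteq> C\<close> by (intro borel_measurable_eq borel_measurable_sum borel_measurable_times) auto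
    qed
    then show "{x \<in> space (PiM C (\<lambda>_. borel)). ?P x} \<in> sets (PiM C (\<lambda>_. borel))"
      using \<open>finite C\<close> by (intro sets.sets_Collect_finite_All) auto
    fix y :: "'c \<Rightarrow> real"
    define a where "a j = (\<Sum>t\<in>T. c j t * y t)" for j
    have "(\<Sum>t\<in>T. c j t * (\<lambda>i\<in>C. if i \<in> C - T then Y i \<omega> else y i) t) = a j" for j \<omega>
      unfolding a_def using \<open>T \<subseteq> C\<close> by (intro sum.cong) auto
    then have eq: "{\<omega> \<in> space M. ?P (\<lambda>i\<in>C. if i \<in> C - T then Y i \<omega> else y i)} =
        {\<omega> \<in> space M. \<forall>j\<in>C - T. Y j \<omega> = a j}" by auto
    show "prob {\<omega> \<in> space M. ?P (\<lambda>i\<in>C. if i \<in> C - T then Y i \<omega> else y i)} \<le> q ^ card (C - T)"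
    proof (cases "C - T = {}")
      case True
      show ?thesis unfolding True by simp
    next
      case False
      have "{\<omega> \<in> space M. \<forall>j\<in>C - T. Y j \<omega> = a j} = (\<Inter>j\<in>C - T. Y j -` {a j} \<inter> space M)"
        using False by auto
      also have "prob \<dots> = (\<Prod>j\<in>C - T. prob (Y j -` {a j} \<inter> space M))"
        using False \<open>finite C\<close> by (intro indep_varsD[OF ind]) auto
      also have "\<dots> \<le> (\<Prod>j\<in>C - T. q)"
        using atom by (intro prod_mono) (auto simp: vimage_def Int_def conj_commute)
      finally show ?thesis unfolding eq by simp
    qed
  qed
  moreover have "{\<omega> \<in> space M. ?P (\<lambda>i\<in>C. Y i \<omega>)} =
      {\<omega> \<in> space M. \<forall>j\<in>C - T. Y j \<omega> = (\<Sum>t\<in>T. c j t * Y t \<omega>)}"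
    unfolding sum_restrict by auto
  ultimately show ?thesis by simp
qed

lemma prob_lin_dep_insert_freeze:
  fixes X :: "'r \<times> 'c \<Rightarrow> 'a \<Rightarrow> real" and H :: "('r \<Rightarrow> 'c \<Rightarrow> real) \<Rightarrow> bool"
  assumes ind: "indep_vars (\<lambda>_. borel) X (insert r0 R \<times> C)"
    and fin: "finite R" "finite C" "r0 \<notin> R" and "0 \<le> \<delta>"
    and H_cong: "\<And>f g. (\<And>r j. r \<in> R \<Longrightarrow> j \<in> C \<Longrightarrow> f r j = g r j) \<Longrightarrow> H f \<longleftrightarrow> H g"
    and H_meas: "{x \<in> space (PiM (insert r0 R \<times> C) (\<lambda>_. borel)). H (\<lambda>r j. x (r, j))}
      \<in> sets (PiM (insert r0 R \<times> C) (\<lambda>_. borel))"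
    and bound: "\<And>f. H f \<Longrightarrow> \<exists>E\<in>events. prob E \<le> \<delta> \<and>
      (\<forall>\<omega>\<in>space M. \<forall>w. (\<forall>j\<in>C. X (r0, j) \<omega> = (\<Sum>r\<in>R. w r * f r j)) \<longrightarrow> \<omega> \<in> E)"
  shows "prob {\<omega> \<in> space M. H (\<lambda>r j. X (r, j) \<omega>) \<and> lin_dep (insert r0 R) C (\<lambda>r j. X (r, j) \<omega>) \<and>
    \<not> lin_dep R C (\<lambda>r j. X (r, j) \<omega>)} \<le> \<delta>"
proof -
  let ?I = "insert r0 R \<times> C"
  let ?B = "PiM ?I (\<lambda>_. borel :: real measure)"
  define P where "P f \<longleftrightarrow> H f \<and> lin_dep (insert r0 R) C f \<and> \<not> lin_dep R C f" for f :: "'r \<Rightarrow> 'c \<Rightarrow> real"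
  have P_cong: "P f \<longleftrightarrow> P g" if "\<And>r j. r \<in> insert r0 R \<Longrightarrow> j \<in> C \<Longrightarrow> f r j = g r j" for f g
    unfolding P_def
    using that H_cong[of f g] lin_dep_cong[of "insert r0 R" C f g] lin_dep_cong[of R C f g] by simp
  have "prob {\<omega> \<in> space M. P (\<lambda>r j. (\<lambda>i\<in>?I. X i \<omega>) (r, j))} \<le> \<delta>"
  proof (rule prob_le_of_freeze[OF ind, of "{r0} \<times> C" "\<lambda>x. P (\<lambda>r j. x (r, j))"])
    show "{r0} \<times> C \<subseteq> ?I" by blast
    have comp: "(\<lambda>x. x (r, j)) \<in> borel_measurable ?B" if "r \<in> insert r0 R" "j \<in> C" for r j
      using that by (intro measurable_component_singleton) auto
    have "{x \<in> space ?B. P (\<lambda>r j. x (r, j))} = {x \<in> space ?B. H (\<lambda>r j. x (r, j))} \<inter>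
        ({x \<in> space ?B. lin_dep (insert r0 R) C (\<lambda>r j. x (r, j))} - {x \<in> space ?B. lin_dep R C (\<lambda>r j. x (r, j))})"
      by (auto simp: P_def)
    also have "\<dots> \<in> sets ?B"
      using fin comp by (intro sets.Int sets.Diff H_meas sets_lin_dep) auto
    finally show "{x \<in> space ?B. P (\<lambda>r j. x (r, j))} \<in> sets ?B" .
    fix y :: "'r \<times> 'c \<Rightarrow> real"
    define g where "g \<omega> r j = (if r = r0 then X (r0, j) \<omega> else y (r, j))" for \<omega> r j
    have "{\<omega> \<in> space M. P (\<lambda>r j. (\<lambda>i\<in>?I. if i \<in> {r0} \<times> C then X i \<omega> else y i) (r, j))} = {\<omega> \<in> space M. P (g \<omega>)}"
      by (intro Collect_cong conj_cong refl P_cong) (auto simp: g_def)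
    moreover have "prob {\<omega> \<in> space M. P (g \<omega>)} \<le> \<delta>"
    proof (cases "H (\<lambda>r j. y (r, j))")
      case True
      then obtain E where E: "E \<in> events" "prob E \<le> \<delta>"
        and sub: "\<And>\<omega> w. \<omega> \<in> space M \<Longrightarrow>
          (\<forall>j\<in>C. X (r0, j) \<omega> = (\<Sum>r\<in>R. w r * y (r, j))) \<Longrightarrow> \<omega> \<in> E"
        using bound[of "\<lambda>r j. y (r, j)"] by blast
      have "{\<omega> \<in> space M. P (g \<omega>)} \<subseteq> E"
      proof safe
        fix \<omega> assume \<omega>: "\<omega> \<in> space M" "P (g \<omega>)"
        then obtain w where w: "\<And>j. j \<in> C \<Longrightarrow> g \<omega> r0 j = (\<Sum>r\<in>R. w r * g \<omega> r j)"
          using in_span_of_lin_dep_insert[OF fin(1,3), of C "g \<omega>"] unfolding P_def by metis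
        have "(\<Sum>r\<in>R. w r * g \<omega> r j) = (\<Sum>r\<in>R. w r * y (r, j))" for j
          using fin by (intro sum.cong) (auto simp: g_def)
        then show "\<omega> \<in> E" using w \<omega> by (intro sub[of _ w]) (auto simp: g_def)
      qed
      then show ?thesis using E finite_measure_mono order_trans by blast
    next
      case False
      moreover have "H (g \<omega>) \<longleftrightarrow> H (\<lambda>r j. y (r, j))" for \<omega>
        using fin by (intro H_cong) (auto simp: g_def)
      ultimately show ?thesis using \<open>0 \<le> \<delta>\<close> by (simp add: P_def)
    qed
    ultimately show "prob {\<omega> \<in> space M. P (\<lambda>r j. (\<lambda>i\<in>?I. if i \<in> {r0} \<times> C then X i \<omega> else y i) (r, j))} \<le> \<delta>"
      by simp
  qed
  also have "{\<omega> \<in> space M. P (\<lambda>r j. (\<lambda>i\<in>?I. X i \<omega>) (r, j))} = {\<omega> \<in> space M. P (\<lambda>r j. X (r, j) \<omega>)}"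
    by (intro Collect_cong conj_cong refl P_cong) auto
  finally show ?thesis unfolding P_def .
qed

lemma indep_vars_row:
  assumes "indep_vars (\<lambda>_. borel) X (R \<times> C)" "r0 \<in> R"
  shows "indep_vars (\<lambda>_. borel) (\<lambda>j. X (r0, j)) C"
  using indep_vars_reindex[OF assms(1), of "Pair r0" C] assms(2) by (auto simp: inj_on_def)

lemma sets_lin_dep_rv:
  fixes X :: "'r \<times> 'c \<Rightarrow> 'a \<Rightarrow> real"
  assumes "indep_vars (\<lambda>_. borel) X (R \<times> C)" "finite R" "finite C"
  shows "{\<omega> \<in> space M. lin_dep R C (\<lambda>r j. X (r, j) \<omega>)} \<in> events"
  using assms by (intro sets_lin_dep) (auto simp: indep_vars_def)

lemma prob_lin_dep_insert_le:
  fixes X :: "'r \<times> 'c \<Rightarrow> 'a \<Rightarrow> real"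
  assumes ind: "indep_vars (\<lambda>_. borel) X (insert r0 R \<times> C)"
    and fin: "finite R" "finite C" "r0 \<notin> R" and q: "0 \<le> q" "q \<le> 1"
    and atom: "\<And>j a. j \<in> C \<Longrightarrow> prob {\<omega> \<in> space M. X (r0, j) \<omega> = a} \<le> q"
  shows "prob {\<omega> \<in> space M. lin_dep (insert r0 R) C (\<lambda>r j. X (r, j) \<omega>) \<and>
    \<not> lin_dep R C (\<lambda>r j. X (r, j) \<omega>)} \<le> q ^ (card C - card R)"
proof -
  have row: "indep_vars (\<lambda>_. borel) (\<lambda>j. X (r0, j)) C"
    using ind by (rule indep_vars_row) simp
  then have [measurable]: "random_variable borel (X (r0, j))" if "j \<in> C" for j
    using that by (auto simp: indep_vars_def)
  have "\<exists>E\<in>events. prob E \<le> q ^ (card C - card R) \<and>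
      (\<forall>\<omega>\<in>space M. \<forall>w. (\<forall>j\<in>C. X (r0, j) \<omega> = (\<Sum>r\<in>R. w r * f r j)) \<longrightarrow> \<omega> \<in> E)" for f :: "'r \<Rightarrow> 'c \<Rightarrow> real"
  proof -
    obtain T c where T: "T \<subseteq> C" "card T \<le> card R"
      and c: "\<forall>r\<in>R. \<forall>j\<in>C. f r j = (\<Sum>t\<in>T. c j t * f r t)"
      using pivot_columns[OF fin(1,2), of f] by blast
    let ?E = "{\<omega> \<in> space M. \<forall>j\<in>C - T. X (r0, j) \<omega> = (\<Sum>t\<in>T. c j t * X (r0, t) \<omega>)}"
    have "?E \<in> events"
      using fin T by (intro sets.sets_Collect_finite_All borel_measurable_eq borel_measurable_sum
          borel_measurable_times) auto
    moreover have "prob ?E \<le> q ^ (card C - card R)"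
    proof -
      have "prob ?E \<le> q ^ card (C - T)"
        by (rule prob_linear_relations_le[OF row fin(2) T(1) q(1) atom])
      also have "\<dots> \<le> q ^ (card C - card R)"
        using q T fin by (intro power_decreasing) (auto simp: card_Diff_subset finite_subset)
      finally show ?thesis .
    qed
    moreover have "\<omega> \<in> ?E" if "\<omega> \<in> space M" and w: "\<forall>j\<in>C. X (r0, j) \<omega> = (\<Sum>r\<in>R. w r * f r j)" for \<omega> w
    proof -
      have "X (r0, j) \<omega> = (\<Sum>t\<in>T. c j t * X (r0, t) \<omega>)" if "j \<in> C" for j
      proof -
        have "X (r0, j) \<omega> = (\<Sum>r\<in>R. w r * (\<Sum>t\<in>T. c j t * f r t))"
          using w c that by auto
        also have "\<dots> = (\<Sum>r\<in>R. \<Sum>t\<in>T. c j t * (w r * f r t))"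
          by (simp add: sum_distrib_left mult.left_commute)
        also have "\<dots> = (\<Sum>t\<in>T. c j t * (\<Sum>r\<in>R. w r * f r t))"
          by (subst sum.swap) (simp add: sum_distrib_left)
        also have "\<dots> = (\<Sum>t\<in>T. c j t * X (r0, t) \<omega>)"
          using w T by (intro sum.cong) auto
        finally show ?thesis .
      qed
      then show ?thesis using that by simp
    qed
    ultimately show ?thesis by blast
  qed
  then show ?thesis
    using prob_lin_dep_insert_freeze[OF ind fin, of "q ^ (card C - card R)" "\<lambda>_. True"] q by simp
qed

text \<open>Union bound over the row at which dependence first appears; with \<open>i\<close> rows
  present the next one costs \<open>q ^ (card C - i)\<close>.\<close>

lemma prob_lin_dep_le:
  fixes X :: "'r \<times> 'c \<Rightarrow> 'a \<Rightarrow> real"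
  assumes "finite R" and "indep_vars (\<lambda>_. borel) X (R \<times> C)"
    and "finite C" and q: "0 \<le> q" "q \<le> 1"
    and "\<And>r j a. r \<in> R \<Longrightarrow> j \<in> C \<Longrightarrow> prob {\<omega> \<in> space M. X (r, j) \<omega> = a} \<le> q"
  shows "prob {\<omega> \<in> space M. lin_dep R C (\<lambda>r j. X (r, j) \<omega>)} \<le> (\<Sum>i<card R. q ^ (card C - i))"
  using assms(1,2,6)
proof (induction R rule: finite_induct)
  case empty
  then show ?case by simp
next
  case (insert r0 R)
  let ?D = "\<lambda>R. {\<omega> \<in> space M. lin_dep R C (\<lambda>r j. X (r, j) \<omega>)}"
  have ind: "indep_vars (\<lambda>_. borel) X (R \<times> C)"
    using insert.prems(1) by (rule indep_vars_subset) auto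
  note ev = sets_lin_dep_rv[OF ind insert.hyps(1) \<open>finite C\<close>]
    sets_lin_dep_rv[OF insert.prems(1) _ \<open>finite C\<close>]
  have "prob (?D (insert r0 R)) \<le> prob (?D R \<union> (?D (insert r0 R) - ?D R))"
    using ev insert.hyps by (intro finite_measure_mono sets.Un sets.Diff) auto
  also have "\<dots> \<le> prob (?D R) + prob (?D (insert r0 R) - ?D R)"
    using ev insert.hyps by (intro measure_Un_le sets.Diff) auto
  also have "?D (insert r0 R) - ?D R = {\<omega> \<in> space M. lin_dep (insert r0 R) C (\<lambda>r j. X (r, j) \<omega>) \<and>
      \<not> lin_dep R C (\<lambda>r j. X (r, j) \<omega>)}" by blast
  also have "prob (?D R) + prob \<dots> \<le> (\<Sum>i<card R. q ^ (card C - i)) + q ^ (card C - card R)"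
    using insert.prems insert.hyps ind \<open>finite C\<close> q
    by (intro add_mono insert.IH prob_lin_dep_insert_le) auto
  finally show ?case using insert.hyps by simp
qed

section \<open>The last rows: orthogonal vectors with large support\<close>

text \<open>The transposed dependence \<open>lin_dep S R'\<close> says that a nonzero vector
  supported on \<open>S\<close> is orthogonal to all rows in \<open>R'\<close>. When no
  \<open>S\<close> of size \<open>k\<close> allows this, a nonzero \<open>v\<close> orthogonal to
  the rows in \<open>R\<close> has at least \<open>k\<close> nonzero entries. A new row in the span
  is orthogonal to \<open>v\<close> too, and the Littlewood--Offord bound applies with the one-point
  target 0.\<close>

lemma prob_lin_dep_insert_le_of_spread:
  fixes X :: "'r \<times> 'c \<Rightarrow> 'a \<Rightarrow> real"
  assumes ind: "indep_vars (\<lambda>_. borel) X (insert r0 R \<times> C)"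
    and fin: "finite R" "finite C" "r0 \<notin> R" and "card R < card C" "R' \<subseteq> R" "k \<le> card C"
    and \<rho>: "0 \<le> \<rho>" "\<rho> \<le> 1" and "N > 0"
    and pos: "\<And>j. j \<in> C \<Longrightarrow> \<rho> \<le> prob {\<omega> \<in> space M. X (r0, j) \<omega> > 0}"
    and neg: "\<And>j. j \<in> C \<Longrightarrow> \<rho> \<le> prob {\<omega> \<in> space M. X (r0, j) \<omega> < 0}"
  shows "prob {\<omega> \<in> space M. \<not> (\<exists>S\<subseteq>C. card S = k \<and> lin_dep S R' (\<lambda>j r. X (r, j) \<omega>)) \<and>
      lin_dep (insert r0 R) C (\<lambda>r j. X (r, j) \<omega>) \<and> \<not> lin_dep R C (\<lambda>r j. X (r, j) \<omega>)}
    \<le> 1 / real N + (1 - \<rho> / (real N)\<^sup>2) ^ k * real N"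
proof (rule prob_lin_dep_insert_freeze[OF ind fin,
      where H = "\<lambda>f. \<not> (\<exists>S\<subseteq>C. card S = k \<and> lin_dep S R' (\<lambda>j r. f r j))"])
  let ?B = "PiM (insert r0 R \<times> C) (\<lambda>_. borel :: real measure)"
  define \<theta> where "\<theta> = 1 - \<rho> / (real N)\<^sup>2"
  have "1 \<le> (real N)\<^sup>2" using \<open>N > 0\<close> by (simp add: one_le_power)
  then have \<theta>: "0 \<le> \<theta>" "\<theta> \<le> 1"
    using \<rho> by (simp_all add: \<theta>_def divide_le_eq)
  then show "0 \<le> 1 / real N + (1 - \<rho> / (real N)\<^sup>2) ^ k * real N"
    by (simp add: \<theta>_def)
  show "\<not> (\<exists>S\<subseteq>C. card S = k \<and> lin_dep S R' (\<lambda>j r. f r j)) \<longleftrightarrow>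
      \<not> (\<exists>S\<subseteq>C. card S = k \<and> lin_dep S R' (\<lambda>j r. g r j))"
    if fg: "\<And>r j. r \<in> R \<Longrightarrow> j \<in> C \<Longrightarrow> f r j = g r j" for f g
  proof -
    have "lin_dep S R' (\<lambda>j r. f r j) \<longleftrightarrow> lin_dep S R' (\<lambda>j r. g r j)" if "S \<subseteq> C" for S
      using that fg \<open>R' \<subseteq> R\<close> by (intro lin_dep_cong) blast
    then show ?thesis by blast
  qed
  have "{x \<in> space ?B. \<not> (\<exists>S\<subseteq>C. card S = k \<and> lin_dep S R' (\<lambda>j r. x (r, j)))} =
      space ?B - (\<Union>S\<in>{S. S \<subseteq> C \<and> card S = k}. {x \<in> space ?B. lin_dep S R' (\<lambda>j r. x (r, j))})"
    by blast
  also have "\<dots> \<in> sets ?B"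
  proof (intro sets.Diff sets.top sets.finite_UN)
    show "finite {S. S \<subseteq> C \<and> card S = k}" using fin by simp
    fix S assume "S \<in> {S. S \<subseteq> C \<and> card S = k}"
    then show "{x \<in> space ?B. lin_dep S R' (\<lambda>j r. x (r, j))} \<in> sets ?B"
      using fin \<open>R' \<subseteq> R\<close>
      by (intro sets_lin_dep measurable_component_singleton) (auto intro: finite_subset)
  qed
  finally show "{x \<in> space ?B. \<not> (\<exists>S\<subseteq>C. card S = k \<and> lin_dep S R' (\<lambda>j r. x (r, j)))} \<in> sets ?B" .
  fix f :: "'r \<Rightarrow> 'c \<Rightarrow> real"
  assume spread: "\<not> (\<exists>S\<subseteq>C. card S = k \<and> lin_dep S R' (\<lambda>j r. f r j))"
  obtain v where v: "\<exists>j\<in>C. v j \<noteq> 0" and orth: "\<forall>r\<in>R. (\<Sum>j\<in>C. v j * f r j) = 0"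
    using orthogonal_vector_exists[OF fin(1,2) \<open>card R < card C\<close>, of f] by blast
  define J where "J = {j \<in> C. v j \<noteq> 0}"
  have J: "J \<subseteq> C" "finite J" using fin by (auto simp: J_def)
  have sum_J: "(\<Sum>j\<in>S. v j * x j) = (\<Sum>j\<in>J. v j * x j)" if "J \<subseteq> S" "S \<subseteq> C" for S x
    using that fin by (intro sum.mono_neutral_right) (auto simp: J_def intro: finite_subset)
  have "k \<le> card J"
  proof (rule ccontr)
    assume "\<not> k \<le> card J"
    \<comment> \<open>A smaller support is padded with zero entries of \<open>v\<close> to exactly
      \<open>k\<close> coordinates, which fit because \<open>k \<le> card C\<close>.\<close>
    then obtain S where S: "J \<subseteq> S" "S \<subseteq> C" "card S = k"
      using exists_subset_between[of J k C] J fin \<open>k \<le> card C\<close> by auto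
    have "(\<Sum>j\<in>S. v j * f r j) = 0" if "r \<in> R'" for r
      using orth that \<open>R' \<subseteq> R\<close> sum_J[OF S(1,2)] sum_J[OF J(1) order_refl] by auto
    then have "lin_dep S R' (\<lambda>j r. f r j)"
      unfolding lin_dep_def using v S by (intro exI[of _ v]) (auto simp: J_def)
    with spread S show False by blast
  qed
  have row: "indep_vars (\<lambda>_. borel) (\<lambda>j. X (r0, j)) C"
    using ind by (rule indep_vars_row) simp
  then have [measurable]: "random_variable borel (X (r0, j))" if "j \<in> C" for j
    using that by (auto simp: indep_vars_def)
  have indJ: "indep_vars (\<lambda>_. borel) (\<lambda>j \<omega>. v j * X (r0, j) \<omega>) J"
    using indep_vars_subset[OF row J(1)] by (rule indep_vars_compose2) simp
  let ?E = "{\<omega> \<in> space M. (\<Sum>j\<in>J. v j * X (r0, j) \<omega>) \<in> {0}}"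
  have "?E \<in> events"
    using J by (auto intro!: borel_measurable_eq borel_measurable_sum borel_measurable_times)
  moreover have "prob ?E \<le> 1 / real N + \<theta> ^ k * real N"
  proof -
    have "prob ?E \<le> real (card {0::real}) / real N +
        \<theta> ^ card J * (real (card {0::real}) * (real N - real (card {0::real})))"
      unfolding \<theta>_def
    proof (rule prob_sum_mem_le[OF J(2) indJ _ _ \<rho> \<open>N > 0\<close>])
      \<comment> \<open>Multiplication by a negative \<open>v j\<close> exchanges the two sign
        events; both have the same lower bound \<open>\<rho>\<close>.\<close>
      fix j assume "j \<in> J"
      then have j: "j \<in> C" "v j > 0 \<or> v j < 0" using J by (auto simp: J_def)
      then show "\<rho> \<le> prob {\<omega> \<in> space M. v j * X (r0, j) \<omega> > 0}"
        "\<rho> \<le> prob {\<omega> \<in> space M. v j * X (r0, j) \<omega> < 0}"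
        using pos[of j] neg[of j] by (auto simp: zero_less_mult_iff mult_less_0_iff)
    qed (use \<open>N > 0\<close> in auto)
    also have "\<dots> \<le> 1 / real N + \<theta> ^ k * real N"
      using \<theta> \<open>k \<le> card J\<close> \<open>N > 0\<close> by (auto intro!: mult_mono power_decreasing)
    finally show ?thesis .
  qed
  moreover have "\<omega> \<in> ?E" if "\<omega> \<in> space M" and w: "\<forall>j\<in>C. X (r0, j) \<omega> = (\<Sum>r\<in>R. w r * f r j)" for \<omega> w
  proof -
    have "(\<Sum>j\<in>J. v j * X (r0, j) \<omega>) = (\<Sum>j\<in>C. v j * X (r0, j) \<omega>)"
      using sum_J[OF J(1) order_refl] by simp
    also have "\<dots> = (\<Sum>j\<in>C. \<Sum>r\<in>R. w r * (v j * f r j))"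
      using w by (intro sum.cong) (auto simp: sum_distrib_left mult.left_commute)
    also have "\<dots> = (\<Sum>r\<in>R. w r * (\<Sum>j\<in>C. v j * f r j))"
      by (subst sum.swap) (simp add: sum_distrib_left)
    also have "\<dots> = 0" using orth by simp
    finally show ?thesis using that by simp
  qed
  ultimately show "\<exists>E\<in>events. prob E \<le> 1 / real N + (1 - \<rho> / (real N)\<^sup>2) ^ k * real N \<and>
      (\<forall>\<omega>\<in>space M. \<forall>w. (\<forall>j\<in>C. X (r0, j) \<omega> = (\<Sum>r\<in>R. w r * f r j)) \<longrightarrow> \<omega> \<in> E)"
    unfolding \<theta>_def by blast
qed

section \<open>The quantitative bound for square arrays\<close>

text \<open>The three terms account, in order, for dependence among the first \<open>n - L\<close>
  rows, for a vector supported on \<open>k\<close> coordinates and orthogonal to all of these rows,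
  and for dependence arising at one of the last \<open>L\<close> rows.\<close>

lemma prob_lin_dep_square_le:
  fixes X :: "nat \<times> nat \<Rightarrow> 'a \<Rightarrow> real"
  assumes ind: "indep_vars (\<lambda>_. borel) X ({..<n} \<times> {..<n})"
    and "L + k \<le> n" and \<rho>: "0 < \<rho>" "\<rho> \<le> 1" and "N > 0"
    and pos: "\<And>i j. i < n \<Longrightarrow> j < n \<Longrightarrow> \<rho> \<le> prob {\<omega> \<in> space M. X (i, j) \<omega> > 0}"
    and neg: "\<And>i j. i < n \<Longrightarrow> j < n \<Longrightarrow> \<rho> \<le> prob {\<omega> \<in> space M. X (i, j) \<omega> < 0}"
  shows "prob {\<omega> \<in> space M. lin_dep {..<n} {..<n} (\<lambda>r j. X (r, j) \<omega>)} \<le>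
    (1 - \<rho>) ^ L / \<rho> + real n ^ k * (real k * (1 - \<rho>) ^ (n - L - k)) +
    real L * (1 / real N + (1 - \<rho> / (real N)\<^sup>2) ^ k * real N)"
proof -
  define q where "q = 1 - \<rho>"
  have q: "0 \<le> q" "q < 1" "q \<le> 1" using \<rho> by (auto simp: q_def)
  define m where "m = n - L"
  define \<delta> where "\<delta> = 1 / real N + (1 - \<rho> / (real N)\<^sup>2) ^ k * real N"
  have rv [measurable]: "random_variable borel (X (i, j))" if "i < n" "j < n" for i j
    using ind that by (auto simp: indep_vars_def)
  have atom: "prob {\<omega> \<in> space M. X (i, j) \<omega> = a} \<le> q" if ij: "i < n" "j < n" for i j a
  proof -
    \<comment> \<open>A single point misses at least one of the two open half-lines, each of
      probability at least \<open>\<rho>\<close>; hence no atom exceeds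
      \<open>1 - \<rho>\<close>.\<close>
    obtain Q where Q: "Q = {0<..} \<or> Q = {..<0::real}" "a \<notin> Q"
    proof (cases "a > 0")
      case True
      then show ?thesis by (intro that[of "{..<0}"]) auto
    next
      case False
      then show ?thesis by (intro that[of "{0<..}"]) auto
    qed
    have "Q \<in> sets borel" using Q by auto
    then have ev: "X (i, j) -` Q \<inter> space M \<in> events" using rv[OF ij] by (rule measurable_sets[rotated])
    have "prob {\<omega> \<in> space M. X (i, j) \<omega> = a} \<le> prob (space M - X (i, j) -` Q \<inter> space M)"
      using Q ev by (intro finite_measure_mono) auto
    also have "\<dots> = 1 - prob (X (i, j) -` Q \<inter> space M)"
      using ev by (rule prob_compl)
    also have "\<dots> \<le> q"
      using Q pos[OF ij] neg[OF ij] by (auto simp: q_def vimage_def Int_def conj_commute)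
    finally show ?thesis .
  qed
  define D where "D i = {\<omega> \<in> space M. lin_dep {..<i} {..<n} (\<lambda>r j. X (r, j) \<omega>)}" for i
  define B where "B S = {\<omega> \<in> space M. lin_dep S {..<m} (\<lambda>j r. X (r, j) \<omega>)}" for S
  define Bad where "Bad = (\<Union>S\<in>{S. S \<subseteq> {..<n} \<and> card S = k}. B S)"
  have finS: "finite {S. S \<subseteq> {..<n} \<and> card S = k}" by simp
  have D_ev: "D i \<in> events" if "i \<le> n" for i
    unfolding D_def using that
    by (intro sets_lin_dep_rv indep_vars_subset[OF ind]) auto
  have B_ev: "B S \<in> events" if "S \<subseteq> {..<n}" for S
    unfolding B_def using that finite_subset[OF that]
    by (intro sets_lin_dep rv) (auto simp: m_def)
  have Bad_ev: "Bad \<in> events"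
    unfolding Bad_def using finS B_ev by (intro sets.finite_UN) auto
  have "prob (D m) \<le> (\<Sum>i<m. q ^ (n - i))"
    unfolding D_def using prob_lin_dep_le[of "{..<m}" X "{..<n}" q,
      OF _ indep_vars_subset[OF ind]] q atom
    by (force simp: m_def)
  \<comment> \<open>Here \<open>n - i\<close> equals \<open>L + (m - i)\<close>. Giving up one
    factor \<open>q\<close> turns the exponents into \<open>0, ..., m - 1\<close> in reverse order,
    and the geometric series is at most \<open>1 / \<rho>\<close>.\<close>
  also have "\<dots> \<le> (\<Sum>i<m. q ^ L * q ^ (m - Suc i))"
    unfolding power_add[symmetric] using q \<open>L + k \<le> n\<close>
    by (intro sum_mono power_decreasing) (auto simp: m_def)
  also have "\<dots> = q ^ L * (\<Sum>i<m. q ^ i)"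
    using sum.nat_diff_reindex[of "\<lambda>i. q ^ i" m] by (simp add: sum_distrib_left[symmetric])
  also have "\<dots> \<le> q ^ L * (1 / \<rho>)"
    using q \<rho> by (intro mult_left_mono) (auto simp: sum_gp_strict q_def divide_right_mono)
  finally have Dm: "prob (D m) \<le> q ^ L / \<rho>" by simp
  \<comment> \<open>Transposed view: the coordinates in \<open>S\<close> now index \<open>k\<close>
    vectors of length \<open>m\<close>, to which the bound for few rows applies.\<close>
  have B_le: "prob (B S) \<le> real k * q ^ (m - k)" if S: "S \<subseteq> {..<n}" "card S = k" for S
  proof -
    have "indep_vars (\<lambda>_. borel) (\<lambda>p. X (prod.swap p)) (S \<times> {..<m})"
      using S by (intro indep_vars_reindex[OF ind]) (auto simp: m_def)
    moreover have "prob {\<omega> \<in> space M. X (prod.swap (j, r)) \<omega> = a} \<le> q" if "j \<in> S" "r < m" for j r a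
      using atom[of r j a] that S by (auto simp: m_def)
    ultimately have "prob (B S) \<le> (\<Sum>i<card S. q ^ (m - i))"
      using prob_lin_dep_le[of S "\<lambda>p. X (prod.swap p)" "{..<m}" q] q finite_subset[OF S(1)]
      by (auto simp: B_def)
    also have "\<dots> \<le> (\<Sum>i<k. q ^ (m - k))"
      unfolding S(2) using q by (intro sum_mono power_decreasing) auto
    finally show ?thesis by simp
  qed
  have "prob Bad \<le> (\<Sum>S\<in>{S. S \<subseteq> {..<n} \<and> card S = k}. prob (B S))"
    unfolding Bad_def using finS B_ev by (intro measure_UNION_le) auto
  also have "\<dots> \<le> (\<Sum>S\<in>{S. S \<subseteq> {..<n} \<and> card S = k}. real k * q ^ (m - k))"
    using B_le by (intro sum_mono) auto
  also have "\<dots> = real (n choose k) * (real k * q ^ (m - k))"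
    using n_subsets[of "{..<n}" k] by simp
  also have "\<dots> \<le> real n ^ k * (real k * q ^ (m - k))"
    using q binomial_le_pow[of k n] \<open>L + k \<le> n\<close>
    by (intro mult_right_mono) (auto simp flip: of_nat_power)
  finally have Bad_le: "prob Bad \<le> real n ^ k * (real k * q ^ (m - k))" .
  have step: "prob (D (Suc i) - D i - Bad) \<le> \<delta>" if i: "m \<le> i" "i < n" for i
  proof -
    have "D (Suc i) - D i - Bad = {\<omega> \<in> space M.
        \<not> (\<exists>S\<subseteq>{..<n}. card S = k \<and> lin_dep S {..<m} (\<lambda>j r. X (r, j) \<omega>)) \<and>
        lin_dep (insert i {..<i}) {..<n} (\<lambda>r j. X (r, j) \<omega>) \<and> \<not> lin_dep {..<i} {..<n} (\<lambda>r j. X (r, j) \<omega>)}"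
      by (auto simp: D_def Bad_def B_def lessThan_Suc)
    also have "prob \<dots> \<le> \<delta>"
      unfolding \<delta>_def using i \<rho> \<open>N > 0\<close> pos neg \<open>L + k \<le> n\<close>
      by (intro prob_lin_dep_insert_le_of_spread indep_vars_subset[OF ind]) auto
    finally show ?thesis .
  qed
  \<comment> \<open>Staying outside \<open>Bad\<close> throughout, each further row costs
    \<open>\<delta>\<close>; the probability of \<open>Bad\<close> itself is paid only once, at the
    end.\<close>
  have "prob (D (m + l) - Bad) \<le> prob (D m) + real l * \<delta>" if "m + l \<le> n" for l
    using that
  proof (induction l)
    case 0
    show ?case using D_ev Bad_ev 0 by (auto intro!: finite_measure_mono)
  next
    case (Suc l)
    have ev: "D (m + l) \<in> events" "D (m + Suc l) \<in> events" using D_ev Suc.prems by auto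
    have "prob (D (m + Suc l) - Bad) \<le> prob ((D (m + l) - Bad) \<union> (D (m + Suc l) - D (m + l) - Bad))"
      using ev Bad_ev by (intro finite_measure_mono) auto
    also have "\<dots> \<le> prob (D (m + l) - Bad) + prob (D (m + Suc l) - D (m + l) - Bad)"
      using ev Bad_ev by (intro measure_Un_le) auto
    also have "\<dots> \<le> (prob (D m) + real l * \<delta>) + \<delta>"
      using Suc step[of "m + l"] by (intro add_mono) auto
    finally show ?case by (simp add: algebra_simps)
  qed
  from this[of L] have DL: "prob (D n - Bad) \<le> prob (D m) + real L * \<delta>"
    using \<open>L + k \<le> n\<close> by (simp add: m_def)
  have "prob (D n) \<le> prob ((D n - Bad) \<union> Bad)"
    using D_ev[of n] Bad_ev by (intro finite_measure_mono) auto
  also have "\<dots> \<le> prob (D n - Bad) + prob Bad"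
    using D_ev[of n] Bad_ev by (intro measure_Un_le) auto
  finally show ?thesis
    using DL Dm Bad_le unfolding D_def \<delta>_def q_def m_def by linarith
qed

end

section \<open>From determinants to linear dependence, and the limit\<close>

text \<open>A kernel vector of a singular matrix is a dependence between its columns, so the first
  index of the array is the column index and the entries appear transposed.\<close>

lemma lin_dep_of_det_eq_0:
  assumes "Determinant.det (random_matrix n \<xi> \<omega>) = 0"
  shows "lin_dep {..<n} {..<n} (\<lambda>r j. \<xi> j r \<omega>)"
proof -
  have "random_matrix n \<xi> \<omega> \<in> carrier_mat n n" by (simp add: random_matrix_def)
  then obtain v where v: "v \<in> carrier_vec n" "v \<noteq> 0\<^sub>v n" and 0: "random_matrix n \<xi> \<omega> *\<^sub>v v = 0\<^sub>v n"
    using assms det_0_iff_vec_prod_zero by blast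
  have "\<exists>r<n. v $ r \<noteq> 0" using v by (auto simp: vec_eq_iff)
  moreover have "(\<Sum>r<n. v $ r * \<xi> j r \<omega>) = 0" if "j < n" for j
  proof -
    have "(random_matrix n \<xi> \<omega> *\<^sub>v v) $ j = 0" using 0 that by simp
    then show ?thesis
      using that v by (simp add: random_matrix_def scalar_prod_def lessThan_atLeast0 mult.commute)
  qed
  ultimately show ?thesis
    unfolding lin_dep_def by (intro exI[of _ "\<lambda>r. v $ r"]) auto
qed

theorem theorem8p1:
  fixes c \<rho> :: real
    and M :: "nat \<Rightarrow> 'a measure"
    and \<xi> :: "nat \<Rightarrow> nat \<Rightarrow> nat \<Rightarrow> 'a \<Rightarrow> real"
  assumes "c > 0" and "\<rho> > 0"
    and "\<And>n. prob_space (M n)"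
    and "\<And>n. prob_space.indep_vars (M n) (\<lambda>_. borel) (\<lambda>(i, j). \<xi> n i j) ({..<n} \<times> {..<n})"
    and "\<And>n i j. i < n \<Longrightarrow> j < n \<Longrightarrow> cr_property (M n) c \<rho> (\<xi> n i j)"
  shows "(\<lambda>n. \<P>(\<omega> in M n. Determinant.det (random_matrix n (\<xi> n) \<omega>) = 0)) \<in> o(\<lambda>_. 1)"
proof -
  \<comment> \<open>The property passes to smaller constants. Capping at \<open>1/2\<close> keeps
    \<open>1 - \<sigma>\<close> strictly between 0 and 1.\<close>
  define \<sigma> where "\<sigma> = min \<rho> (1/2)"
  have \<sigma>: "0 < \<sigma>" "\<sigma> < 1" using \<open>\<rho> > 0\<close> by (auto simp: \<sigma>_def)
  define pr where "pr n = \<P>(\<omega> in M n. Determinant.det (random_matrix n (\<xi> n) \<omega>) = 0)" for n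
  have bound: "pr n \<le> (1 - \<sigma>) ^ L / \<sigma> + real n ^ k * (real k * (1 - \<sigma>) ^ (n - L - k)) +
      real L * (1 / real N + (1 - \<sigma> / (real N)\<^sup>2) ^ k * real N)" if "L + k \<le> n" "N > 0" for n L k N
  proof -
    interpret prob_space "M n" by fact
    define X where "X p = \<xi> n (snd p) (fst p)" for p
    have ind: "indep_vars (\<lambda>_. borel) X ({..<n} \<times> {..<n})"
      using indep_vars_reindex[OF assms(4)[of n], of prod.swap "{..<n} \<times> {..<n}"]
      by (auto simp: X_def[abs_def] case_prod_beta image_subset_iff)
    have rv: "random_variable borel (X (i, j))" if "i < n" "j < n" for i j
      using ind that by (auto simp: indep_vars_def)
    have sgn: "\<sigma> \<le> prob {\<omega> \<in> space (M n). X (i, j) \<omega> > 0}" "\<sigma> \<le> prob {\<omega> \<in> space (M n). X (i, j) \<omega> < 0}"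
      if ij: "i < n" "j < n" for i j
    proof -
      note [measurable] = rv[OF ij]
      have "\<sigma> \<le> prob {\<omega> \<in> space (M n). X (i, j) \<omega> \<ge> c}" "\<sigma> \<le> prob {\<omega> \<in> space (M n). X (i, j) \<omega> \<le> - c}"
        using assms(5)[OF ij(2,1)] by (auto simp: cr_property_def X_def \<sigma>_def)
      moreover have "prob {\<omega> \<in> space (M n). X (i, j) \<omega> \<ge> c} \<le> prob {\<omega> \<in> space (M n). X (i, j) \<omega> > 0}"
        "prob {\<omega> \<in> space (M n). X (i, j) \<omega> \<le> - c} \<le> prob {\<omega> \<in> space (M n). X (i, j) \<omega> < 0}"
        using \<open>c > 0\<close> by (auto intro!: finite_measure_mono)
      ultimately show "\<sigma> \<le> prob {\<omega> \<in> space (M n). X (i, j) \<omega> > 0}"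
        "\<sigma> \<le> prob {\<omega> \<in> space (M n). X (i, j) \<omega> < 0}" by linarith+
    qed
    have "pr n \<le> prob {\<omega> \<in> space (M n). lin_dep {..<n} {..<n} (\<lambda>r j. X (r, j) \<omega>)}"
      unfolding pr_def using sets_lin_dep_rv[OF ind] lin_dep_of_det_eq_0[of n "\<xi> n"]
      by (intro finite_measure_mono) (auto simp: X_def)
    also have "\<dots> \<le> (1 - \<sigma>) ^ L / \<sigma> + real n ^ k * (real k * (1 - \<sigma>) ^ (n - L - k)) +
      real L * (1 / real N + (1 - \<sigma> / (real N)\<^sup>2) ^ k * real N)"
      using ind that \<sigma> sgn by (intro prob_lin_dep_square_le) auto
    finally show ?thesis .
  qed
  have "pr \<longlonglongrightarrow> 0"
  proof (rule LIMSEQ_I)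
    fix \<epsilon> :: real assume "\<epsilon> > 0"
    \<comment> \<open>The parameters are chosen successively, each giving an error below
      \<open>\<epsilon> / 4\<close>: \<open>L\<close>, then \<open>N\<close> depending on
      \<open>L\<close>, then \<open>k\<close> depending on both, and finally a threshold for
      \<open>n\<close>.\<close>
    have "(\<lambda>L. (1 - \<sigma>) ^ L / \<sigma>) \<longlonglongrightarrow> 0"
      using \<sigma> by real_asymp
    then obtain L where L: "(1 - \<sigma>) ^ L / \<sigma> < \<epsilon> / 4"
      using \<open>\<epsilon> > 0\<close> by (force dest!: order_tendstoD(2)[where a="\<epsilon> / 4"] simp: eventually_sequentially)
    have "(\<lambda>N. real L * (1 / real N)) \<longlonglongrightarrow> 0"
      by real_asymp
    then have "\<forall>\<^sub>F N in sequentially. real L * (1 / real N) < \<epsilon> / 4"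
      using \<open>\<epsilon> > 0\<close> by (intro order_tendstoD(2)[where a="\<epsilon> / 4"]) auto
    then obtain N where N: "real L * (1 / real N) < \<epsilon> / 4" "N > 0"
      using eventually_happens[OF eventually_conj[OF _ eventually_gt_at_top[of 0]]] by force
    define \<theta> where "\<theta> = 1 - \<sigma> / (real N)\<^sup>2"
    have "1 \<le> (real N)\<^sup>2" using \<open>N > 0\<close> by (simp add: one_le_power)
    then have "\<sigma> < (real N)\<^sup>2" using \<sigma> by linarith
    then have \<theta>: "0 < \<theta>" "\<theta> < 1"
      using \<sigma> \<open>N > 0\<close> by (auto simp: \<theta>_def divide_less_eq)
    have "(\<lambda>k. real L * (\<theta> ^ k * real N)) \<longlonglongrightarrow> 0"
      using \<theta> by real_asymp
    then obtain k where k: "real L * (\<theta> ^ k * real N) < \<epsilon> / 4"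
      using \<open>\<epsilon> > 0\<close> by (force dest!: order_tendstoD(2)[where a="\<epsilon> / 4"] simp: eventually_sequentially)
    have "(\<lambda>n. real n ^ k * (real k * (1 - \<sigma>) ^ (n - L - k))) \<longlonglongrightarrow> 0"
      using \<sigma> by real_asymp
    then have "\<forall>\<^sub>F n in sequentially. real n ^ k * (real k * (1 - \<sigma>) ^ (n - L - k)) < \<epsilon> / 4"
      using \<open>\<epsilon> > 0\<close> by (intro order_tendstoD(2)[where a="\<epsilon> / 4"]) auto
    then obtain n0 where n0: "\<And>n. n \<ge> n0 \<Longrightarrow> real n ^ k * (real k * (1 - \<sigma>) ^ (n - L - k)) < \<epsilon> / 4"
      by (auto simp: eventually_sequentially)
    have "norm (pr n - 0) < \<epsilon>" if "n \<ge> max n0 (L + k)" for n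
    proof -
      have "pr n \<le> (1 - \<sigma>) ^ L / \<sigma> + real n ^ k * (real k * (1 - \<sigma>) ^ (n - L - k)) +
          (real L * (1 / real N) + real L * (\<theta> ^ k * real N))"
        using bound[of L k n N] that \<open>N > 0\<close> by (simp add: \<theta>_def distrib_left)
      also have "\<dots> < \<epsilon>"
        using L N k n0[of n] that by linarith
      finally show ?thesis by (simp add: pr_def)
    qed
    then show "\<exists>no. \<forall>n\<ge>no. norm (pr n - 0) < \<epsilon>" by blast
  qed
  then show ?thesis
    unfolding pr_def[abs_def] by (intro smalloI_tendsto) simp_all
qed

end
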